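(* Let $G$ be a discrete group. For every $n\ge 1$ let $\psi_n$ be the condition $$\sup_{\substack{\|f_1\|=1\\ f_1\ge 0}}\cdots\sup_{\substack{\|f_n\|=1\\ f_n\ge 0}}\ \inf_{\substack{\|g\|=1\\ g\ge 0}}\ \max\{d(g,f_1*g),\dots,d(g,f_n*g)\}=0 ,$$ where $f_1,\dots,f_n,g$ range over $\ell^1(G)$. Then $G$ is amenable if and only if $\ell^1(G)\models\psi_n$ (i.e. the displayed equality holds in $\ell^1(G)$) for every $n\ge 1$.
   Context: $\ell^1(G)$ is the real Banach lattice of functions $f:G\to\mathbb{R}$ with $\|f\|=\sum_{x\in G}|f(x)|<\infty$, with pointwise order, convolution $(f*g)(x)=\sum_{y\in G}f(y)g(y^{-1}x)$ and metric $d(f,g)=\|f-g\|$. A discrete group $G$ is amenable if one of the following equivalent conditions holds: (1) there is a net $(h_\gamma)$ of finitely supported elements of $\ell^1(G)$ with $\|h_\gamma\|=1$ and $\lim_\gamma\|h_\gamma*\mathbf{1}_a-h_\gamma\|=0$ for every $a\in G$ (where $\mathbf{1}_a$ is the characteristic function of $\{a\}$); (2) (Følner) there is a net $(X_i)_{i\in I}$ of finite (nonempty) subsets of $G$ with $\lim_i |(gX_i)\triangle X_i|/|X_i|=0$ for every $g\in G$. *)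

theory Defs
  imports "HOL-Algebra.Group" "HOL-Analysis.Infinite_Sum"
begin

text \<open>
  Functions on the group are total functions on the ambient type that vanish outside the carrier,
  so that distinct elements of the space are distinct as functions.
\<close>

definition l1_space :: "('a, 'b) monoid_scheme \<Rightarrow> ('a \<Rightarrow> real) set" where
  "l1_space G =
     {f. (\<forall>x. x \<notin> carrier G \<longrightarrow> f x = 0) \<and> (\<lambda>x. \<bar>f x\<bar>) summable_on carrier G}"

definition l1_norm :: "('a, 'b) monoid_scheme \<Rightarrow> ('a \<Rightarrow> real) \<Rightarrow> real" where
  "l1_norm G f = (\<Sum>\<^sub>\<infinity>x\<in>carrier G. \<bar>f x\<bar>)"

definition l1_dist :: "('a, 'b) monoid_scheme \<Rightarrow> ('a \<Rightarrow> real) \<Rightarrow> ('a \<Rightarrow> real) \<Rightarrow> real" where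
  "l1_dist G f g = l1_norm G (\<lambda>x. f x - g x)"

definition l1_conv ::
    "('a, 'b) monoid_scheme \<Rightarrow> ('a \<Rightarrow> real) \<Rightarrow> ('a \<Rightarrow> real) \<Rightarrow> 'a \<Rightarrow> real" where
  "l1_conv G f g x =
     (if x \<in> carrier G
      then (\<Sum>\<^sub>\<infinity>y\<in>carrier G. f y * g (inv\<^bsub>G\<^esub> y \<otimes>\<^bsub>G\<^esub> x)) else 0)"

text \<open>
  Nets are rendered by proper filters: a net corresponds to the image of its
  filter of tails. The lemmas \<open>amenable_if_net\<close> and \<open>amenable_imp_net\<close>
  below show that this agrees with nets over arbitrary directed sets.
\<close>

definition amenable :: "('a, 'b) monoid_scheme \<Rightarrow> bool" where
  "amenable G \<longleftrightarrow>
     (\<exists>F :: ('a \<Rightarrow> real) filter. F \<noteq> bot \<and>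
        (\<forall>\<^sub>F h in F. h \<in> l1_space G \<and> finite {x. h x \<noteq> 0} \<and> l1_norm G h = 1) \<and>
        (\<forall>a\<in>carrier G.
           ((\<lambda>h. l1_norm G (\<lambda>x. l1_conv G h (indicator {a}) x - h x)) \<longlongrightarrow> 0) F))"

definition l1_pos_sphere :: "('a, 'b) monoid_scheme \<Rightarrow> ('a \<Rightarrow> real) set" where
  "l1_pos_sphere G = {f \<in> l1_space G. l1_norm G f = 1 \<and> (\<forall>x\<in>carrier G. 0 \<le> f x)}"

text \<open>
  \<open>psi_value G n fs\<close> is the value of the innermost \<open>inf\<close>--\<open>max\<close> expression preceded by \<open>n\<close>
  suprema, where the list \<open>fs\<close> holds the values of the outer variables already chosen. All the
  distances involved lie between \<open>0\<close> and \<open>2\<close> and the index set is nonempty for a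
  group, so the suprema and infima are genuine ones in the reals. The \<open>Max\<close> is only meaningful
  when \<open>fs\<close> is nonempty, which is the case for at least one supremum.
\<close>

primrec psi_value :: "('a, 'b) monoid_scheme \<Rightarrow> nat \<Rightarrow> ('a \<Rightarrow> real) list \<Rightarrow> real" where
  "psi_value G 0 fs =
     (INF g\<in>l1_pos_sphere G. Max ((\<lambda>f. l1_dist G g (l1_conv G f g)) ` set fs))"
| "psi_value G (Suc n) fs = (SUP f\<in>l1_pos_sphere G. psi_value G n (fs @ [f]))"

definition psi :: "('a, 'b) monoid_scheme \<Rightarrow> nat \<Rightarrow> bool" where
  "psi G n \<longleftrightarrow> psi_value G n [] = 0"

definition directed_preorder :: "'i set \<Rightarrow> ('i \<Rightarrow> 'i \<Rightarrow> bool) \<Rightarrow> bool" where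
  "directed_preorder I r \<longleftrightarrow> I \<noteq> {} \<and> (\<forall>i\<in>I. r i i) \<and>
     (\<forall>i\<in>I. \<forall>j\<in>I. \<forall>k\<in>I. r i j \<longrightarrow> r j k \<longrightarrow> r i k) \<and>
     (\<forall>i\<in>I. \<forall>j\<in>I. \<exists>k\<in>I. r i k \<and> r j k)"

definition reiter_net ::
    "('a, 'b) monoid_scheme \<Rightarrow> 'i set \<Rightarrow> ('i \<Rightarrow> 'i \<Rightarrow> bool) \<Rightarrow> ('i \<Rightarrow> 'a \<Rightarrow> real) \<Rightarrow> bool" where
  "reiter_net G I r h \<longleftrightarrow> directed_preorder I r \<and>
     (\<forall>i\<in>I. h i \<in> l1_space G \<and> finite {x. h i x \<noteq> 0} \<and> l1_norm G (h i) = 1) \<and>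
     (\<forall>a\<in>carrier G. \<forall>e>0. \<exists>i\<in>I. \<forall>j\<in>I. r i j \<longrightarrow>
        \<bar>l1_norm G (\<lambda>x. l1_conv G (h j) (indicator {a}) x - h j x)\<bar> < e)"

lemma amenable_if_net:
  fixes I :: "'i set"
  assumes "reiter_net G I r h"
  shows "amenable G"
proof -
  have dir: "directed_preorder I r"
    and h: "\<And>i. i \<in> I \<Longrightarrow> h i \<in> l1_space G \<and> finite {x. h i x \<noteq> 0} \<and> l1_norm G (h i) = 1"
    and lim: "\<And>a e. a \<in> carrier G \<Longrightarrow> e > 0 \<Longrightarrow> \<exists>i\<in>I. \<forall>j\<in>I. r i j \<longrightarrow>
        \<bar>l1_norm G (\<lambda>x. l1_conv G (h j) (indicator {a}) x - h j x)\<bar> < e"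
    using assms unfolding reiter_net_def by blast+
  define T where "T = (INF i\<in>I. principal {j \<in> I. r i j})"
  have T: "eventually P T \<longleftrightarrow> (\<exists>i\<in>I. \<forall>j\<in>I. r i j \<longrightarrow> P j)" for P
    unfolding T_def
  proof (subst eventually_INF_base)
    show "I \<noteq> {}" using dir by (auto simp: directed_preorder_def)
    fix i j assume "i \<in> I" "j \<in> I"
    then obtain k where "k \<in> I" "r i k" "r j k"
      using dir unfolding directed_preorder_def by blast
    moreover have "r i l" "r j l" if "l \<in> I" "r k l" for l
      using dir calculation \<open>i \<in> I\<close> \<open>j \<in> I\<close> that unfolding directed_preorder_def by metis+
    ultimately show "\<exists>x\<in>I. principal {j \<in> I. r x j} \<le>
        inf (principal {j \<in> I. r i j}) (principal {ja \<in> I. r j ja})"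
      by (intro bexI[of _ k]) auto
  qed (auto simp: eventually_principal)
  have I: "I \<noteq> {}" "\<And>i. i \<in> I \<Longrightarrow> r i i"
    using dir by (auto simp: directed_preorder_def)
  have "\<not> eventually (\<lambda>_. False) T"
    using I by (auto simp: T)
  then have "filtermap h T \<noteq> bot"
    by (auto simp: trivial_limit_def eventually_filtermap)
  moreover have "\<forall>\<^sub>F f in filtermap h T.
      f \<in> l1_space G \<and> finite {x. f x \<noteq> 0} \<and> l1_norm G f = 1"
    using I h by (auto simp: eventually_filtermap T)
  moreover have "((\<lambda>f. l1_norm G (\<lambda>x. l1_conv G f (indicator {a}) x - f x)) \<longlongrightarrow> 0)
      (filtermap h T)" if "a \<in> carrier G" for a
    using lim[OF that] by (auto simp: tendsto_iff eventually_filtermap T)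
  ultimately show ?thesis
    unfolding amenable_def by blast
qed

lemma amenable_imp_net:
  fixes G :: "('a, 'b) monoid_scheme"
  assumes "amenable G"
  shows "\<exists>(I :: (('a \<Rightarrow> real) \<times> ('a \<Rightarrow> real) set) set) r h. reiter_net G I r h"
proof -
  obtain F :: "('a \<Rightarrow> real) filter" where F: "F \<noteq> bot"
    and h: "\<forall>\<^sub>F h in F. h \<in> l1_space G \<and> finite {x. h x \<noteq> 0} \<and> l1_norm G h = 1"
    and lim: "\<And>a. a \<in> carrier G \<Longrightarrow>
        ((\<lambda>h. l1_norm G (\<lambda>x. l1_conv G h (indicator {a}) x - h x)) \<longlongrightarrow> 0) F"
    using assms unfolding amenable_def by blast
  define S where "S = {h. h \<in> l1_space G \<and> finite {x. h x \<noteq> 0} \<and> l1_norm G h = 1}"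
  define I where "I = {(f, A). f \<in> A \<and> A \<subseteq> S \<and> eventually (\<lambda>f. f \<in> A) F}"
  define r :: "('a \<Rightarrow> real) \<times> ('a \<Rightarrow> real) set \<Rightarrow> ('a \<Rightarrow> real) \<times> ('a \<Rightarrow> real) set \<Rightarrow> bool"
    where "r = (\<lambda>i j. snd j \<subseteq> snd i)"
  have mem: "\<exists>f. (f, A) \<in> I" if "A \<subseteq> S" "eventually (\<lambda>f. f \<in> A) F" for A
    using eventually_happens'[OF F that(2)] that by (auto simp: I_def)
  have S: "eventually (\<lambda>f. f \<in> S) F"
    using h by (simp add: S_def)
  have "directed_preorder I r"
    unfolding directed_preorder_def
  proof (intro conjI ballI)
    show "I \<noteq> {}" using mem[OF subset_refl S] by blast
    fix i j assume ij: "i \<in> I" "j \<in> I"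
    then have "snd i \<inter> snd j \<subseteq> S" "eventually (\<lambda>f. f \<in> snd i \<inter> snd j) F"
      by (auto simp: I_def eventually_conj_iff)
    from mem[OF this] obtain f where "(f, snd i \<inter> snd j) \<in> I" ..
    then show "\<exists>k\<in>I. r i k \<and> r j k"
      by (rule bexI[rotated]) (simp add: r_def)
  qed (auto simp: r_def)
  moreover have "\<exists>i\<in>I. \<forall>j\<in>I. r i j \<longrightarrow>
      \<bar>l1_norm G (\<lambda>x. l1_conv G (fst j) (indicator {a}) x - fst j x)\<bar> < e"
    if "a \<in> carrier G" "e > 0" for a e
  proof -
    define A where
      "A = {f \<in> S. \<bar>l1_norm G (\<lambda>x. l1_conv G f (indicator {a}) x - f x)\<bar> < e}"
    have "eventually (\<lambda>f. f \<in> A) F"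
      using S lim[OF that(1)] that(2) by (auto simp: A_def tendsto_iff eventually_conj_iff)
    moreover have "A \<subseteq> S" by (auto simp: A_def)
    ultimately obtain f where f: "(f, A) \<in> I" using mem by blast
    show ?thesis
    proof (intro bexI[OF _ f] ballI impI)
      fix j assume "j \<in> I" "r (f, A) j"
      then have "fst j \<in> A" by (auto simp: I_def r_def)
      then show "\<bar>l1_norm G (\<lambda>x. l1_conv G (fst j) (indicator {a}) x - fst j x)\<bar> < e"
        by (simp add: A_def)
    qed
  qed
  moreover have "\<forall>i\<in>I. fst i \<in> l1_space G \<and> finite {x. fst i x \<noteq> 0} \<and> l1_norm G (fst i) = 1"
    by (auto simp: I_def S_def)
  ultimately show ?thesis
    unfolding reiter_net_def by blast
qed

end

theory Submission
  imports Defs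
begin

text \<open>
  Call \<open>\<Sum>x. \<bar>g x - g (a\<inverse> x)\<bar>\<close> the translation defect of \<open>g\<close> at \<open>a\<close>; it equals \<open>d(g, 1\<^sub>a * g)\<close>
  and is at most \<open>2 \<parallel>g\<parallel>\<close>. For \<open>f\<close> on the positive unit sphere, \<open>f * g\<close> is the \<open>f\<close>-average of the
  left translates of \<open>g\<close>, so \<open>d(g, f * g)\<close> is at most the \<open>f\<close>-average of the defects. As \<open>f\<close> is
  concentrated up to \<open>\<epsilon>\<close> on a finite set, almost invariance of \<open>g\<close> under finitely many
  translations controls \<open>d(g, f * g)\<close> for finitely many \<open>f\<close> at once. Conversely, taking
  \<open>f\<^sub>i = 1\<^sub>a\<close> in the conditions \<open>\<psi>\<^sub>n\<close> gives almost invariant \<open>g\<close>, which are cut off to a finite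
  set and normalised. The map \<open>x \<mapsto> x\<inverse>\<close> exchanges left translates with the right translates
  occurring in amenability, and passing to absolute values does not increase defects.
\<close>

definition translation_defect :: "('a, 'b) monoid_scheme \<Rightarrow> ('a \<Rightarrow> real) \<Rightarrow> 'a \<Rightarrow> real" where
  "translation_defect G g a = (\<Sum>\<^sub>\<infinity>x\<in>carrier G. \<bar>g x - g (inv\<^bsub>G\<^esub> a \<otimes>\<^bsub>G\<^esub> x)\<bar>)"

text \<open>The explicit 0 is needed because \<open>inv\<close> is unspecified off the carrier; it
  keeps the flip inside \<open>l1_space\<close> and makes it an involution there.\<close>

definition l1_flip :: "('a, 'b) monoid_scheme \<Rightarrow> ('a \<Rightarrow> real) \<Rightarrow> 'a \<Rightarrow> real" where
  "l1_flip G g x = (if x \<in> carrier G then g (inv\<^bsub>G\<^esub> x) else 0)"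

lemma translation_defect_nonneg: "0 \<le> translation_defect G g a"
  unfolding translation_defect_def by (intro infsum_nonneg) auto

section \<open>Small tails of summable functions\<close>

lemma infsum_tail_le:
  fixes f :: "'a \<Rightarrow> real"
  assumes "f summable_on A" "e > 0"
  obtains K where "finite K" "K \<subseteq> A" "infsum f (A - K) \<le> e"
proof -
  obtain K where K: "finite K" "K \<subseteq> A" "dist (sum f K) (infsum f A) \<le> e"
    using infsum_finite_approximation[OF assms] by blast
  have "infsum f (A - K) = infsum f A - infsum f K"
    by (rule infsum_Diff) (use assms K in auto)
  also have "\<dots> \<le> e"
    using K by (auto simp: dist_real_def)
  finally show ?thesis
    using that K by blast
qed

text \<open>For nonnegative functions the tail only shrinks when the removed set grows, so the union
  of finite sets chosen for each \<open>f\<close> separately serves all of them.\<close>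

lemma infsum_uniform_tail_le:
  fixes fs :: "('a \<Rightarrow> real) set"
  assumes "finite fs" and summ: "\<And>f. f \<in> fs \<Longrightarrow> f summable_on A"
    and nonneg: "\<And>f x. f \<in> fs \<Longrightarrow> x \<in> A \<Longrightarrow> 0 \<le> f x" and "e > 0"
  obtains K where "finite K" "K \<subseteq> A" "\<And>f. f \<in> fs \<Longrightarrow> infsum f (A - K) \<le> e"
proof -
  have "\<forall>f\<in>fs. \<exists>K. finite K \<and> K \<subseteq> A \<and> infsum f (A - K) \<le> e"
    using infsum_tail_le summ \<open>e > 0\<close> by metis
  then obtain K where K: "\<And>f. f \<in> fs \<Longrightarrow> finite (K f) \<and> K f \<subseteq> A \<and> infsum f (A - K f) \<le> e"
    by metis
  have "infsum f (A - \<Union>(K ` fs)) \<le> e" if f: "f \<in> fs" for f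
  proof -
    have "infsum f (A - \<Union>(K ` fs)) \<le> infsum f (A - K f)"
      by (intro infsum_mono_neutral summable_on_subset_banach[OF summ[OF f]])
        (use f nonneg in auto)
    then show ?thesis using K[OF f] by linarith
  qed
  then show ?thesis
    using that[of "\<Union>(K ` fs)"] K \<open>finite fs\<close> by blast
qed

context group
begin

section \<open>Left translations and the translation defect\<close>

lemma bij_betw_lmult: "a \<in> carrier G \<Longrightarrow> bij_betw (\<lambda>x. a \<otimes> x) (carrier G) (carrier G)"
  by (rule bij_betwI[where g = "\<lambda>x. inv a \<otimes> x"]) (auto simp: m_assoc[symmetric])

lemma bij_betw_m_inv: "bij_betw (\<lambda>x. inv x) (carrier G) (carrier G)"
  by (rule bij_betwI[where g = "\<lambda>x. inv x"]) auto

lemma l1_translate: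
  assumes "g \<in> l1_space G" "a \<in> carrier G"
  shows "(\<lambda>x. \<bar>g (a \<otimes> x)\<bar>) summable_on carrier G"
    and "(\<Sum>\<^sub>\<infinity>x\<in>carrier G. \<bar>g (a \<otimes> x)\<bar>) = l1_norm G g"
  using assms summable_on_reindex_bij_betw[OF bij_betw_lmult[OF assms(2)], of "\<lambda>x. \<bar>g x\<bar>"]
    infsum_reindex_bij_betw[OF bij_betw_lmult[OF assms(2)], of "\<lambda>x. \<bar>g x\<bar>"]
  by (auto simp: l1_space_def l1_norm_def)

lemma translation_defect_summable:
  assumes "g \<in> l1_space G" "a \<in> carrier G"
  shows "(\<lambda>x. \<bar>g x - g (inv a \<otimes> x)\<bar>) summable_on carrier G"
proof (rule summable_on_comparison_test)
  show "(\<lambda>x. \<bar>g x\<bar> + \<bar>g (inv a \<otimes> x)\<bar>) summable_on carrier G"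
    using assms by (intro summable_on_add l1_translate) (auto simp: l1_space_def)
qed auto

lemma translation_defect_le:
  assumes "g \<in> l1_space G" "a \<in> carrier G"
  shows "translation_defect G g a \<le> 2 * l1_norm G g"
proof -
  have s: "(\<lambda>x. \<bar>g x\<bar>) summable_on carrier G" "(\<lambda>x. \<bar>g (inv a \<otimes> x)\<bar>) summable_on carrier G"
    using assms l1_translate(1)[of g "inv a"] by (auto simp: l1_space_def)
  have "translation_defect G g a \<le> (\<Sum>\<^sub>\<infinity>x\<in>carrier G. \<bar>g x\<bar> + \<bar>g (inv a \<otimes> x)\<bar>)"
    unfolding translation_defect_def
    by (intro infsum_mono translation_defect_summable summable_on_add s assms) auto
  also have "\<dots> = 2 * l1_norm G g"
    using assms l1_translate(2)[of g "inv a"] by (simp add: infsum_add s l1_norm_def)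
  finally show ?thesis .
qed

text \<open>The defect is subadditive and \<open>k = g - (g - k)\<close>; the defect of the
  difference is bounded crudely by twice its norm.\<close>

lemma translation_defect_diff_le:
  assumes "g \<in> l1_space G" "k \<in> l1_space G" "(\<lambda>x. g x - k x) \<in> l1_space G" "a \<in> carrier G"
  shows "translation_defect G k a \<le> translation_defect G g a + 2 * l1_norm G (\<lambda>x. g x - k x)"
proof -
  note s = translation_defect_summable[OF assms(1,4)] translation_defect_summable[OF assms(3,4)]
  have "translation_defect G k a \<le> (\<Sum>\<^sub>\<infinity>x\<in>carrier G. \<bar>g x - g (inv a \<otimes> x)\<bar> +
      \<bar>g x - k x - (g (inv a \<otimes> x) - k (inv a \<otimes> x))\<bar>)"
    unfolding translation_defect_def
    by (intro infsum_mono translation_defect_summable summable_on_add s assms) auto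
  also have "\<dots> = translation_defect G g a + translation_defect G (\<lambda>x. g x - k x) a"
    unfolding translation_defect_def by (rule infsum_add[OF s])
  also have "\<dots> \<le> translation_defect G g a + 2 * l1_norm G (\<lambda>x. g x - k x)"
    using translation_defect_le[OF assms(3,4)] by simp
  finally show ?thesis .
qed

section \<open>Convolution by elements of the positive unit sphere\<close>

lemma l1_pos_sphereD:
  assumes "f \<in> l1_pos_sphere G"
  shows "f \<in> l1_space G" "l1_norm G f = 1" "\<And>x. 0 \<le> f x" "f summable_on carrier G"
    "infsum f (carrier G) = 1"
proof -
  show *: "0 \<le> f x" for x
    using assms by (cases "x \<in> carrier G") (auto simp: l1_pos_sphere_def l1_space_def)
  show "f \<in> l1_space G" "l1_norm G f = 1" "f summable_on carrier G" "infsum f (carrier G) = 1"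
    using assms by (auto simp: l1_pos_sphere_def l1_space_def l1_norm_def *)
qed

text \<open>As \<open>f\<close> has total mass 1, \<open>g x\<close> is itself the
  \<open>f\<close>-average of the constant \<open>g x\<close>, so
  \<open>g x - l1_conv G f g x\<close> is the \<open>f\<close>-average of
  \<open>g x - g (inv y \<otimes> x)\<close> over \<open>y\<close>. Taking absolute values, summing
  over \<open>x\<close> and exchanging the sums gives the bound.\<close>

lemma dist_conv_le_weighted_defect:
  assumes f: "f \<in> l1_pos_sphere G" and g: "g \<in> l1_space G"
  shows "(\<lambda>y. f y * translation_defect G g y) summable_on carrier G"
    and "l1_dist G g (l1_conv G f g) \<le> (\<Sum>\<^sub>\<infinity>y\<in>carrier G. f y * translation_defect G g y)"
proof -
  note fD = l1_pos_sphereD[OF f]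
  let ?C = "carrier G"
  let ?k = "\<lambda>x y. f y * \<bar>g x - g (inv y \<otimes> x)\<bar>"
  show s: "(\<lambda>y. f y * translation_defect G g y) summable_on ?C"
  proof (rule summable_on_comparison_test)
    show "(\<lambda>y. f y * (2 * l1_norm G g)) summable_on ?C"
      by (intro summable_on_cmult_left fD)
  qed (auto intro!: mult_left_mono translation_defect_le g fD mult_nonneg_nonneg translation_defect_nonneg)
  have hs: "((\<lambda>x. ?k x y) has_sum (f y * translation_defect G g y)) ?C" if "y \<in> ?C" for y
    unfolding translation_defect_def
    by (intro has_sum_cmult_right has_sum_infsum translation_defect_summable g that)
  \<comment> \<open>The family is nonnegative, so it is summable on the product once its sums over
    \<open>x\<close> are summable in \<open>y\<close>. This licenses the exchange of sums
    below.\<close>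
  have "(\<lambda>(y, x). ?k x y) summable_on (?C \<times> ?C)"
    by (rule summable_on_SigmaI[where g = "\<lambda>y. f y * translation_defect G g y"])
      (use hs s fD in auto)
  then have sum2: "(\<lambda>(x, y). ?k x y) summable_on (?C \<times> ?C)"
    using summable_on_swap[of "\<lambda>(y, x). ?k x y" ?C ?C] by (simp add: case_prod_unfold)
  have row: "(\<lambda>y. ?k x y) summable_on ?C" if "x \<in> ?C" for x
    using summable_on_SigmaD1[OF sum2 that] by simp
  have rows: "(\<lambda>x. \<Sum>\<^sub>\<infinity>y\<in>?C. ?k x y) summable_on ?C"
    using summable_on_Sigma_banach[OF sum2] by simp
  have pointwise: "\<bar>g x - l1_conv G f g x\<bar> \<le> (\<Sum>\<^sub>\<infinity>y\<in>?C. ?k x y)" if x: "x \<in> ?C" for x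
  proof -
    have k: "norm (f y * (g (inv y \<otimes> x) - g x)) = ?k x y" for y
      using fD(3) by (simp add: abs_mult abs_minus_commute)
    have abs_row: "(\<lambda>y. norm (f y * (g (inv y \<otimes> x) - g x))) summable_on ?C"
      unfolding k by (rule row[OF x])
    have const: "(\<lambda>y. f y * g x) summable_on ?C" "(\<Sum>\<^sub>\<infinity>y\<in>?C. f y * g x) = g x"
      using fD(4,5) by (auto intro: summable_on_cmult_left simp: infsum_cmult_left')
    have "l1_conv G f g x = (\<Sum>\<^sub>\<infinity>y\<in>?C. f y * g x + f y * (g (inv y \<otimes> x) - g x))"
      using x by (simp add: l1_conv_def algebra_simps)
    also have "\<dots> = g x + (\<Sum>\<^sub>\<infinity>y\<in>?C. f y * (g (inv y \<otimes> x) - g x))"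
      using infsum_add[OF const(1) abs_summable_summable[OF abs_row]] const(2) by simp
    finally have "\<bar>g x - l1_conv G f g x\<bar> = norm (\<Sum>\<^sub>\<infinity>y\<in>?C. f y * (g (inv y \<otimes> x) - g x))"
      by simp
    also have "\<dots> \<le> (\<Sum>\<^sub>\<infinity>y\<in>?C. norm (f y * (g (inv y \<otimes> x) - g x)))"
      by (rule norm_infsum_bound[OF abs_row])
    also have "\<dots> = (\<Sum>\<^sub>\<infinity>y\<in>?C. ?k x y)"
      by (simp only: k)
    finally show ?thesis .
  qed
  have "l1_dist G g (l1_conv G f g) \<le> (\<Sum>\<^sub>\<infinity>x\<in>?C. \<Sum>\<^sub>\<infinity>y\<in>?C. ?k x y)"
    unfolding l1_dist_def l1_norm_def
    by (intro infsum_mono summable_on_comparison_test[OF rows] rows pointwise) auto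
  also have "\<dots> = (\<Sum>\<^sub>\<infinity>y\<in>?C. \<Sum>\<^sub>\<infinity>x\<in>?C. ?k x y)"
    by (rule infsum_swap_banach[OF sum2])
  also have "\<dots> = (\<Sum>\<^sub>\<infinity>y\<in>?C. f y * translation_defect G g y)"
    by (intro infsum_cong infsumI hs)
  finally show "l1_dist G g (l1_conv G f g) \<le> \<dots>" .
qed

lemma l1_dist_nonneg: "0 \<le> l1_dist G f g"
  unfolding l1_dist_def l1_norm_def by (intro infsum_nonneg) auto

text \<open>An average of defects, each at most 2. It supplies the upper bound needed later to
  handle the suprema in \<open>psi_value\<close>.\<close>

lemma dist_conv_le_2:
  assumes f: "f \<in> l1_pos_sphere G" and g: "g \<in> l1_pos_sphere G"
  shows "l1_dist G g (l1_conv G f g) \<le> 2"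
proof -
  note fD = l1_pos_sphereD[OF f] and gD = l1_pos_sphereD[OF g]
  note w = dist_conv_le_weighted_defect[OF f gD(1)]
  have "(\<Sum>\<^sub>\<infinity>y\<in>carrier G. f y * translation_defect G g y) \<le> (\<Sum>\<^sub>\<infinity>y\<in>carrier G. f y * 2)"
    using translation_defect_le[OF gD(1)] gD(2)
    by (intro infsum_mono w summable_on_cmult_left fD mult_left_mono) auto
  also have "\<dots> = 2"
    using fD by (simp add: infsum_cmult_left')
  finally show ?thesis using w(2) by linarith
qed

text \<open>Points of \<open>K\<close> contribute at most \<open>e\<close> times the mass of
  \<open>f\<close>, hence at most \<open>e\<close>. Off \<open>K\<close> the defect is only known to
  be at most 2, but the mass there is at most \<open>e\<close>, which adds
  \<open>2 * e\<close>.\<close>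

lemma dist_conv_le_tail:
  assumes f: "f \<in> l1_pos_sphere G" and g: "g \<in> l1_pos_sphere G"
    and "e \<ge> 0" and tail: "infsum f (carrier G - K) \<le> e"
    and K: "\<And>a. a \<in> K \<Longrightarrow> translation_defect G g a \<le> e"
  shows "l1_dist G g (l1_conv G f g) \<le> 3 * e"
proof -
  note fD = l1_pos_sphereD[OF f] and gD = l1_pos_sphereD[OF g]
  note w = dist_conv_le_weighted_defect[OF f gD(1)]
  \<comment> \<open>The part of \<open>f\<close> off \<open>K\<close>, extended by zero so that both
    contributions can be summed over the whole carrier.\<close>
  let ?t = "\<lambda>y. if y \<in> K then 0 else f y"
  have t: "?t summable_on carrier G"
    by (rule summable_on_comparison_test[OF fD(4)]) (use fD in auto)
  have "infsum ?t (carrier G) = infsum f (carrier G - K)"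
    by (rule infsum_cong_neutral) auto
  with tail have te: "infsum ?t (carrier G) \<le> e" by simp
  have "(\<Sum>\<^sub>\<infinity>y\<in>carrier G. f y * translation_defect G g y)
      \<le> (\<Sum>\<^sub>\<infinity>y\<in>carrier G. f y * e + ?t y * 2)"
  proof (intro infsum_mono w summable_on_add summable_on_cmult_left fD t)
    fix y assume y: "y \<in> carrier G"
    show "f y * translation_defect G g y \<le> f y * e + ?t y * 2"
    proof (cases "y \<in> K")
      case True
      then show ?thesis using K fD(3) by (simp add: mult_left_mono)
    next
      case False
      have "f y * translation_defect G g y \<le> f y * 2"
        using translation_defect_le[OF gD(1) y] gD(2) fD(3) by (intro mult_left_mono) auto
      moreover have "0 \<le> f y * e" using fD(3) \<open>e \<ge> 0\<close> by simp
      ultimately show ?thesis using False by simp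
    qed
  qed
  also have "\<dots> = (\<Sum>\<^sub>\<infinity>y\<in>carrier G. f y * e) + (\<Sum>\<^sub>\<infinity>y\<in>carrier G. ?t y * 2)"
    by (intro infsum_add summable_on_cmult_left fD t)
  also have "\<dots> = e + infsum ?t (carrier G) * 2"
    using fD(5) by (simp only: infsum_cmult_left')
  finally show ?thesis using w(2) te by linarith
qed

section \<open>Point masses and inversion\<close>

lemma indicator_in_l1_pos_sphere:
  assumes "a \<in> carrier G"
  shows "indicator {a} \<in> l1_pos_sphere G"
proof -
  have "((\<lambda>x. indicator {a} x :: real) has_sum 1) (carrier G)"
  proof (rule has_sum_cong_neutral[THEN iffD1])
    show "((\<lambda>x. indicator {a} x :: real) has_sum 1) {a}"
      using has_sum_finite[of "{a}" "indicator {a} :: _ \<Rightarrow> real"] by simp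
  qed (use assms in auto)
  then show ?thesis
    using assms
    by (auto simp: l1_pos_sphere_def l1_space_def l1_norm_def indicator_def
        dest: has_sum_imp_summable infsumI)
qed

lemma l1_conv_indicator_left:
  assumes "a \<in> carrier G" "x \<in> carrier G"
  shows "l1_conv G (indicator {a}) g x = g (inv a \<otimes> x)"
proof -
  have "l1_conv G (indicator {a}) g x = (\<Sum>\<^sub>\<infinity>y\<in>{a}. indicator {a} y * g (inv y \<otimes> x))"
    unfolding l1_conv_def if_P[OF assms(2)] by (rule infsum_cong_neutral) (use assms in auto)
  then show ?thesis by simp
qed

text \<open>The factor \<open>indicator {a} (inv y \<otimes> x)\<close> vanishes except at the
  single point \<open>y = x \<otimes> inv a\<close>.\<close>

lemma l1_conv_indicator_right:
  assumes a: "a \<in> carrier G" and x: "x \<in> carrier G"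
  shows "l1_conv G h (indicator {a}) x = h (x \<otimes> inv a)"
proof -
  have "y = x \<otimes> inv a" if "y \<in> carrier G" "inv y \<otimes> x = a" for y
    using that a x by (metis inv_closed inv_mult_group inv_inv inv_solve_left' m_closed)
  then have "l1_conv G h (indicator {a}) x
      = (\<Sum>\<^sub>\<infinity>y\<in>{x \<otimes> inv a}. h y * indicator {a} (inv y \<otimes> x))"
    unfolding l1_conv_def if_P[OF x]
    by (intro infsum_cong_neutral) (use a x in \<open>auto simp: indicator_def\<close>)
  also have "inv (x \<otimes> inv a) \<otimes> x = a"
    using a x by (simp add: inv_mult_group m_assoc)
  then have "(\<Sum>\<^sub>\<infinity>y\<in>{x \<otimes> inv a}. h y * indicator {a} (inv y \<otimes> x)) = h (x \<otimes> inv a)"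
    by simp
  finally show ?thesis .
qed

lemma dist_conv_indicator:
  "a \<in> carrier G \<Longrightarrow> l1_dist G g (l1_conv G (indicator {a}) g) = translation_defect G g a"
  unfolding l1_dist_def l1_norm_def translation_defect_def
  by (intro infsum_cong) (simp add: l1_conv_indicator_left)

text \<open>The bridge between the right translations in \<open>amenable\<close> and the left ones
  in the defect: inversion permutes the carrier and sends \<open>a \<otimes> x\<close> to
  \<open>inv x \<otimes> inv a\<close>.\<close>

lemma right_translation_eq_defect_flip:
  assumes a: "a \<in> carrier G"
  shows "l1_norm G (\<lambda>x. l1_conv G h (indicator {a}) x - h x)
    = translation_defect G (l1_flip G h) (inv a)"
proof -
  have "translation_defect G (l1_flip G h) (inv a)
      = (\<Sum>\<^sub>\<infinity>x\<in>carrier G. \<bar>h (inv x) - h (inv x \<otimes> inv a)\<bar>)"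
    unfolding translation_defect_def l1_flip_def
    using a by (intro infsum_cong) (simp add: inv_mult_group)
  also have "\<dots> = (\<Sum>\<^sub>\<infinity>x\<in>carrier G. \<bar>h x - h (x \<otimes> inv a)\<bar>)"
    by (rule infsum_reindex_bij_betw[OF bij_betw_m_inv, of "\<lambda>x. \<bar>h x - h (x \<otimes> inv a)\<bar>"])
  also have "\<dots> = l1_norm G (\<lambda>x. l1_conv G h (indicator {a}) x - h x)"
    unfolding l1_norm_def using a by (intro infsum_cong) (simp add: l1_conv_indicator_right)
  finally show ?thesis ..
qed

lemma l1_flip:
  assumes "h \<in> l1_space G"
  shows "l1_flip G h \<in> l1_space G" "l1_norm G (l1_flip G h) = l1_norm G h"
    "l1_flip G (l1_flip G h) = h"
proof -
  have "(\<lambda>x. \<bar>h (inv x)\<bar>) summable_on carrier G"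
    using assms summable_on_reindex_bij_betw[OF bij_betw_m_inv, of "\<lambda>x. \<bar>h x\<bar>"]
    by (simp add: l1_space_def)
  also have "?this \<longleftrightarrow> (\<lambda>x. \<bar>l1_flip G h x\<bar>) summable_on carrier G"
    by (intro summable_on_cong) (simp add: l1_flip_def)
  finally show "l1_flip G h \<in> l1_space G"
    by (auto simp: l1_space_def l1_flip_def)
  have "l1_norm G (l1_flip G h) = (\<Sum>\<^sub>\<infinity>x\<in>carrier G. \<bar>h (inv x)\<bar>)"
    unfolding l1_norm_def by (intro infsum_cong) (simp add: l1_flip_def)
  then show "l1_norm G (l1_flip G h) = l1_norm G h"
    using infsum_reindex_bij_betw[OF bij_betw_m_inv, of "\<lambda>x. \<bar>h x\<bar>"] by (simp add: l1_norm_def)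
  show "l1_flip G (l1_flip G h) = h"
    using assms by (auto simp: l1_flip_def l1_space_def fun_eq_iff)
qed

lemma finite_support_flip:
  assumes "finite {x. h x \<noteq> 0}"
  shows "finite {x. l1_flip G h x \<noteq> 0}"
proof (rule finite_subset)
  show "{x. l1_flip G h x \<noteq> 0} \<subseteq> (\<lambda>x. inv x) ` {x. h x \<noteq> 0}"
  proof
    fix x assume "x \<in> {x. l1_flip G h x \<noteq> 0}"
    then have "x \<in> carrier G" "h (inv x) \<noteq> 0"
      by (auto simp: l1_flip_def split: if_splits)
    then show "x \<in> (\<lambda>x. inv x) ` {x. h x \<noteq> 0}"
      by (intro image_eqI[of _ _ "inv x"]) auto
  qed
qed (use assms in simp)

section \<open>Positivity, scaling and truncation\<close>

lemma abs_in_l1_pos_sphere: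
  assumes "h \<in> l1_space G" "l1_norm G h = 1"
  shows "(\<lambda>x. \<bar>h x\<bar>) \<in> l1_pos_sphere G"
  using assms by (auto simp: l1_pos_sphere_def l1_space_def l1_norm_def)

text \<open>The reverse triangle inequality, termwise. It is needed because the functions in
  \<open>amenable\<close> may change sign, while \<open>psi\<close> asks for nonnegative
  ones.\<close>

lemma translation_defect_abs_le:
  assumes "h \<in> l1_space G" "a \<in> carrier G"
  shows "translation_defect G (\<lambda>x. \<bar>h x\<bar>) a \<le> translation_defect G h a"
proof -
  have "(\<lambda>x. \<bar>h x\<bar>) \<in> l1_space G"
    using assms by (auto simp: l1_space_def)
  then show ?thesis
    unfolding translation_defect_def
    by (intro infsum_mono translation_defect_summable assms) auto
qed

lemma translation_defect_cmult:
  "translation_defect G (\<lambda>x. c * g x) a = \<bar>c\<bar> * translation_defect G g a"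
  unfolding translation_defect_def
  by (simp add: abs_mult infsum_cmult_right' flip: right_diff_distrib)

lemma l1_cmult:
  assumes "g \<in> l1_space G"
  shows "(\<lambda>x. c * g x) \<in> l1_space G" "l1_norm G (\<lambda>x. c * g x) = \<bar>c\<bar> * l1_norm G g"
  using assms by (auto simp: l1_space_def l1_norm_def abs_mult infsum_cmult_right'
      intro: summable_on_cmult_right)

text \<open>Restricting \<open>g\<close> to a finite set carrying all but \<open>e\<close> of its
  mass changes it by at most \<open>e\<close> in norm, so the defect stays below
  \<open>e + 2 * e\<close>. The remaining norm is at least \<open>1 / 2\<close>, so normalising at
  most doubles this.\<close>

lemma finite_support_approximation:
  assumes g: "g \<in> l1_pos_sphere G" and e: "0 < e" "e \<le> 1 / 2" and "K \<subseteq> carrier G"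
    and K: "\<And>a. a \<in> K \<Longrightarrow> translation_defect G g a < e"
  obtains k where "k \<in> l1_space G" "finite {x. k x \<noteq> 0}" "l1_norm G k = 1"
    "\<And>a. a \<in> K \<Longrightarrow> translation_defect G k a < 6 * e"
proof -
  note gD = l1_pos_sphereD[OF g]
  obtain S where S: "finite S" "S \<subseteq> carrier G" "infsum g (carrier G - S) \<le> e"
    using infsum_tail_le[OF gD(4) e(1)] by blast
  define k where "k = (\<lambda>x. if x \<in> S then g x else 0)"
  have k: "k \<in> l1_space G"
    using S gD unfolding l1_space_def k_def
    by (auto intro!: summable_on_comparison_test[OF gD(4)])
  have d: "(\<lambda>x. g x - k x) \<in> l1_space G"
    using S gD unfolding l1_space_def k_def
    by (auto intro!: summable_on_comparison_test[OF gD(4)])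
  have norm_d: "l1_norm G (\<lambda>x. g x - k x) = infsum g (carrier G - S)"
    unfolding l1_norm_def k_def by (rule infsum_cong_neutral) (use gD in auto)
  have "l1_norm G k = infsum g S"
    unfolding l1_norm_def k_def by (rule infsum_cong_neutral) (use gD S in auto)
  moreover have "infsum g (carrier G - S) = infsum g (carrier G) - infsum g S"
    by (rule infsum_Diff) (use gD S in auto)
  ultimately have norm_k: "l1_norm G k \<ge> 1 / 2"
    using S(3) e gD(5) by linarith
  let ?c = "1 / l1_norm G k"
  show ?thesis
  proof (rule that[of "\<lambda>x. ?c * k x"])
    show "(\<lambda>x. ?c * k x) \<in> l1_space G" by (rule l1_cmult[OF k])
    show "finite {x. ?c * k x \<noteq> 0}"
      by (rule finite_subset[OF _ S(1)]) (auto simp: k_def)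
    show "l1_norm G (\<lambda>x. ?c * k x) = 1"
      using norm_k by (simp only: l1_cmult(2)[OF k]) simp
    fix a assume a: "a \<in> K"
    then have "a \<in> carrier G" using \<open>K \<subseteq> carrier G\<close> by blast
    then have "translation_defect G k a < 3 * e"
      using translation_defect_diff_le[OF gD(1) k d] K[OF a] norm_d S(3) by fastforce
    moreover have "translation_defect G (\<lambda>x. ?c * k x) a = ?c * translation_defect G k a"
      using norm_k by (simp only: translation_defect_cmult) simp
    moreover have "?c * translation_defect G k a \<le> 2 * translation_defect G k a"
      using norm_k by (intro mult_right_mono translation_defect_nonneg) (auto simp: field_simps)
    ultimately show "translation_defect G (\<lambda>x. ?c * k x) a < 6 * e" by linarith
  qed
qed

section \<open>Unfolding the nested suprema and the infimum\<close>

lemma l1_pos_sphere_nonempty: "l1_pos_sphere G \<noteq> {}"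
  using indicator_in_l1_pos_sphere[OF one_closed] by blast

lemma Max_dist_conv_bounds:
  assumes "set fs \<subseteq> l1_pos_sphere G" "fs \<noteq> []" "g \<in> l1_pos_sphere G"
  shows "0 \<le> Max ((\<lambda>f. l1_dist G g (l1_conv G f g)) ` set fs)"
    and "Max ((\<lambda>f. l1_dist G g (l1_conv G f g)) ` set fs) \<le> 2"
proof -
  obtain f where "f \<in> set fs" using assms(2) by (cases fs) auto
  then show "0 \<le> Max ((\<lambda>f. l1_dist G g (l1_conv G f g)) ` set fs)"
    by (subst Max_ge_iff) (auto intro: l1_dist_nonneg)
  show "Max ((\<lambda>f. l1_dist G g (l1_conv G f g)) ` set fs) \<le> 2"
    using assms dist_conv_le_2 by (subst Max_le_iff) auto
qed

lemma bdd_below_Max_dist_conv: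
  assumes "set fs \<subseteq> l1_pos_sphere G" "fs \<noteq> []"
  shows "bdd_below ((\<lambda>g. Max ((\<lambda>f. l1_dist G g (l1_conv G f g)) ` set fs)) ` l1_pos_sphere G)"
  using Max_dist_conv_bounds(1)[OF assms] by (intro bdd_belowI2[where m = 0]) auto

text \<open>Suprema and infima of reals behave as expected only for nonempty bounded families. The
  condition \<open>n + length fs \<ge> 1\<close> ensures that the list finally reaching
  \<open>Max\<close> is nonempty.\<close>

lemma psi_value_bounds:
  assumes "set fs \<subseteq> l1_pos_sphere G" "n + length fs \<ge> 1"
  shows "0 \<le> psi_value G n fs \<and> psi_value G n fs \<le> 2"
  using assms
proof (induction n arbitrary: fs)
  case 0
  then have fs: "set fs \<subseteq> l1_pos_sphere G" "fs \<noteq> []" by auto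
  obtain g where g: "g \<in> l1_pos_sphere G" using l1_pos_sphere_nonempty by blast
  have "0 \<le> psi_value G 0 fs"
    unfolding psi_value.simps
    by (intro cINF_greatest l1_pos_sphere_nonempty Max_dist_conv_bounds fs)
  moreover have "psi_value G 0 fs \<le> 2"
    unfolding psi_value.simps
    by (rule cINF_lower2[OF bdd_below_Max_dist_conv[OF fs] g]) (rule Max_dist_conv_bounds(2)[OF fs g])
  ultimately show ?case ..
next
  case (Suc n)
  have b: "0 \<le> psi_value G n (fs @ [f])" "psi_value G n (fs @ [f]) \<le> 2"
    if "f \<in> l1_pos_sphere G" for f
    using Suc.IH[of "fs @ [f]"] Suc.prems that by auto
  obtain f where f: "f \<in> l1_pos_sphere G" using l1_pos_sphere_nonempty by blast
  have bdd: "bdd_above ((\<lambda>f. psi_value G n (fs @ [f])) ` l1_pos_sphere G)"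
    by (rule bdd_aboveI2[where M = 2]) (rule b)
  have "0 \<le> psi_value G (Suc n) fs"
    using b(1)[OF f] cSUP_upper[OF f bdd] by simp
  moreover have "psi_value G (Suc n) fs \<le> 2"
    unfolding psi_value.simps by (intro cSUP_least l1_pos_sphere_nonempty b)
  ultimately show ?case ..
qed

text \<open>A bounded supremum of nonnegative numbers is 0 iff every one of them is 0; applied
  \<open>n\<close> times, this turns the suprema into one quantifier over lists.\<close>

lemma psi_value_eq_0_iff:
  assumes "set fs \<subseteq> l1_pos_sphere G" "n + length fs \<ge> 1"
  shows "psi_value G n fs = 0 \<longleftrightarrow>
    (\<forall>gs. set gs \<subseteq> l1_pos_sphere G \<and> length gs = n \<longrightarrow> psi_value G 0 (fs @ gs) = 0)"
  using assms
proof (induction n arbitrary: fs)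
  case 0
  then show ?case by simp
next
  case (Suc n)
  have b: "0 \<le> psi_value G n (fs @ [f])" "psi_value G n (fs @ [f]) \<le> 2"
    if "f \<in> l1_pos_sphere G" for f
    using psi_value_bounds[of "fs @ [f]" n] Suc.prems that by auto
  have bdd: "bdd_above ((\<lambda>f. psi_value G n (fs @ [f])) ` l1_pos_sphere G)"
    by (rule bdd_aboveI2[where M = 2]) (rule b)
  have "psi_value G (Suc n) fs = 0 \<longleftrightarrow> (\<forall>f\<in>l1_pos_sphere G. psi_value G n (fs @ [f]) = 0)"
  proof
    assume *: "psi_value G (Suc n) fs = 0"
    show "\<forall>f\<in>l1_pos_sphere G. psi_value G n (fs @ [f]) = 0"
    proof
      fix f assume f: "f \<in> l1_pos_sphere G"
      then show "psi_value G n (fs @ [f]) = 0"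
        using cSUP_upper[OF f bdd] * b(1)[OF f] by simp
    qed
  qed (simp add: l1_pos_sphere_nonempty)
  also have "\<dots> \<longleftrightarrow> (\<forall>f\<in>l1_pos_sphere G. \<forall>gs. set gs \<subseteq> l1_pos_sphere G \<and> length gs = n \<longrightarrow>
      psi_value G 0 (fs @ f # gs) = 0)"
    using Suc.IH Suc.prems by (intro ball_cong) (simp_all del: psi_value.simps)
  also have "\<dots> \<longleftrightarrow> (\<forall>gs. set gs \<subseteq> l1_pos_sphere G \<and> length gs = Suc n \<longrightarrow>
      psi_value G 0 (fs @ gs) = 0)"
    by (auto simp: length_Suc_conv simp del: psi_value.simps)
  finally show ?case .
qed

text \<open>A nonnegative number is 0 iff it lies below every \<open>e > 0\<close>, and an infimum
  lies below \<open>e\<close> iff some member does.\<close>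

lemma psi_value_0_eq_0_iff:
  assumes fs: "set fs \<subseteq> l1_pos_sphere G" "fs \<noteq> []"
  shows "psi_value G 0 fs = 0 \<longleftrightarrow>
    (\<forall>e>0. \<exists>g\<in>l1_pos_sphere G. \<forall>f\<in>set fs. l1_dist G g (l1_conv G f g) < e)"
proof -
  have "psi_value G 0 fs = 0 \<longleftrightarrow> (\<forall>e>0. psi_value G 0 fs < e)"
    using psi_value_bounds[of fs 0] fs
    by (metis One_nat_def Suc_leI add_0 length_greater_0_conv less_irrefl order_le_less)
  also have "\<dots> \<longleftrightarrow> (\<forall>e>0. \<exists>g\<in>l1_pos_sphere G. \<forall>f\<in>set fs. l1_dist G g (l1_conv G f g) < e)"
    unfolding psi_value.simps
      cINF_less_iff[OF l1_pos_sphere_nonempty bdd_below_Max_dist_conv[OF fs]]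
    using fs by simp
  finally show ?thesis .
qed

lemma psi_iff:
  assumes "n \<ge> 1"
  shows "psi G n \<longleftrightarrow> (\<forall>fs. set fs \<subseteq> l1_pos_sphere G \<and> length fs = n \<longrightarrow>
    (\<forall>e>0. \<exists>g\<in>l1_pos_sphere G. \<forall>f\<in>set fs. l1_dist G g (l1_conv G f g) < e))"
proof -
  have "psi G n \<longleftrightarrow>
      (\<forall>fs. set fs \<subseteq> l1_pos_sphere G \<and> length fs = n \<longrightarrow> psi_value G 0 fs = 0)"
    unfolding psi_def using psi_value_eq_0_iff[of "[]" n] assms by simp
  also have "\<dots> \<longleftrightarrow> (\<forall>fs. set fs \<subseteq> l1_pos_sphere G \<and> length fs = n \<longrightarrow>
    (\<forall>e>0. \<exists>g\<in>l1_pos_sphere G. \<forall>f\<in>set fs. l1_dist G g (l1_conv G f g) < e))"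
  proof (intro all_cong)
    fix fs assume "set fs \<subseteq> l1_pos_sphere G \<and> length fs = n"
    then have "set fs \<subseteq> l1_pos_sphere G" "fs \<noteq> []" using assms by auto
    then show "psi_value G 0 fs = 0 \<longleftrightarrow>
        (\<forall>e>0. \<exists>g\<in>l1_pos_sphere G. \<forall>f\<in>set fs. l1_dist G g (l1_conv G f g) < e)"
      by (rule psi_value_0_eq_0_iff)
  qed
  finally show ?thesis .
qed

section \<open>From amenability to the conditions \<open>psi\<close>\<close>

lemma amenable_imp_psi:
  assumes "amenable G" "n \<ge> 1"
  shows "psi G n"
  unfolding psi_iff[OF assms(2)]
proof (intro allI impI)
  fix fs :: "('a \<Rightarrow> real) list" and e :: real
  assume "set fs \<subseteq> l1_pos_sphere G \<and> length fs = n" and "e > 0"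
  then have fs: "\<And>f. f \<in> set fs \<Longrightarrow> f \<in> l1_pos_sphere G" by auto
  obtain F :: "('a \<Rightarrow> real) filter" where F: "F \<noteq> bot"
    and h: "\<forall>\<^sub>F h in F. h \<in> l1_space G \<and> finite {x. h x \<noteq> 0} \<and> l1_norm G h = 1"
    and lim: "\<And>a. a \<in> carrier G \<Longrightarrow>
        ((\<lambda>h. l1_norm G (\<lambda>x. l1_conv G h (indicator {a}) x - h x)) \<longlongrightarrow> 0) F"
    using assms(1) unfolding amenable_def by blast
  \<comment> \<open>\<open>dist_conv_le_tail\<close> loses a factor 3; dividing by 4 makes the final
    inequality strict.\<close>
  define d where "d = e / 4"
  have d: "d > 0" "3 * d < e" using \<open>e > 0\<close> by (auto simp: d_def)
  obtain K where K: "finite K" "K \<subseteq> carrier G"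
    and tail: "\<And>f. f \<in> set fs \<Longrightarrow> infsum f (carrier G - K) \<le> d"
    by (rule infsum_uniform_tail_le[of "set fs" "carrier G" d])
      (use fs l1_pos_sphereD d(1) in auto)
  \<comment> \<open>Right translation by \<open>inv a\<close> becomes, after the flip, the defect at
    \<open>inv (inv a) = a\<close>.\<close>
  have "\<forall>\<^sub>F h in F. l1_norm G (\<lambda>x. l1_conv G h (indicator {inv a}) x - h x) < d"
    if "a \<in> K" for a
    by (rule order_tendstoD(2)[OF lim d(1)]) (use that K in auto)
  then have "\<forall>\<^sub>F h in F. \<forall>a\<in>K. l1_norm G (\<lambda>x. l1_conv G h (indicator {inv a}) x - h x) < d"
    by (intro eventually_ball_finite K) auto
  from eventually_happens'[OF F eventually_conj[OF h this]] obtain h where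
    h: "h \<in> l1_space G" "l1_norm G h = 1"
    and hK: "\<And>a. a \<in> K \<Longrightarrow> l1_norm G (\<lambda>x. l1_conv G h (indicator {inv a}) x - h x) < d"
    by blast
  let ?g = "\<lambda>x. \<bar>l1_flip G h x\<bar>"
  have g: "?g \<in> l1_pos_sphere G"
    using abs_in_l1_pos_sphere l1_flip[OF h(1)] h(2) by simp
  have "translation_defect G ?g a \<le> d" if "a \<in> K" for a
  proof -
    have a: "a \<in> carrier G" using that K by blast
    have "translation_defect G ?g a \<le> translation_defect G (l1_flip G h) (inv (inv a))"
      using translation_defect_abs_le[OF l1_flip(1)[OF h(1)] a] a by simp
    also have "\<dots> < d"
      using hK[OF that] a by (subst right_translation_eq_defect_flip[symmetric]) auto
    finally show ?thesis by simp
  qed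
  then have "l1_dist G ?g (l1_conv G f ?g) < e" if "f \<in> set fs" for f
    using dist_conv_le_tail[OF fs[OF that] g _ tail[OF that]] d by force
  with g show "\<exists>g\<in>l1_pos_sphere G. \<forall>f\<in>set fs. l1_dist G g (l1_conv G f g) < e" by blast
qed

section \<open>From the conditions \<open>psi\<close> to amenability\<close>

lemma psi_imp_almost_invariant:
  assumes psi: "\<forall>n\<ge>1. psi G n" and K: "finite K" "K \<subseteq> carrier G" and "e > 0"
  obtains g where "g \<in> l1_pos_sphere G" "\<And>a. a \<in> K \<Longrightarrow> translation_defect G g a < e"
proof -
  \<comment> \<open>Adding \<open>\<one>\<close> makes the list nonempty even if \<open>K\<close> is
    empty, so that its length is an admissible \<open>n\<close>.\<close>
  obtain as where as: "set as = insert \<one> K"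
    using finite_list[of "insert \<one> K"] K by auto
  let ?fs = "map (\<lambda>a. indicator {a} :: 'a \<Rightarrow> real) as"
  have asC: "set as \<subseteq> carrier G" using as K by auto
  have "set ?fs \<subseteq> l1_pos_sphere G"
    using asC indicator_in_l1_pos_sphere by auto
  moreover have n: "length ?fs \<ge> 1" using as by (cases as) auto
  ultimately obtain g where g: "g \<in> l1_pos_sphere G"
    "\<And>f. f \<in> set ?fs \<Longrightarrow> l1_dist G g (l1_conv G f g) < e"
    using psi psi_iff[OF n] \<open>e > 0\<close> by blast
  have "translation_defect G g a < e" if "a \<in> K" for a
    using g(2)[of "indicator {a}"] that as K dist_conv_indicator[of a g] by auto
  with g(1) show ?thesis using that by blast
qed

lemma psi_imp_reiter:
  assumes psi: "\<forall>n\<ge>1. psi G n" and K: "finite K" "K \<subseteq> carrier G" and "e > 0"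
  shows "\<exists>h. h \<in> l1_space G \<and> finite {x. h x \<noteq> 0} \<and> l1_norm G h = 1 \<and>
    (\<forall>a\<in>K. l1_norm G (\<lambda>x. l1_conv G h (indicator {a}) x - h x) < e)"
proof -
  \<comment> \<open>Right translation of the flip of \<open>k\<close> by \<open>a\<close> is
    measured by the defect of \<open>k\<close> at \<open>inv a\<close>, hence the inverses. The
    bounds \<open>1 / 2\<close> and \<open>e / 6\<close> match the hypothesis and the factor 6 of
    \<open>finite_support_approximation\<close>.\<close>
  let ?K = "(\<lambda>a. inv a) ` K" and ?d = "min (1 / 2) (e / 6)"
  have d: "?d > 0" "?d \<le> 1 / 2" "6 * ?d \<le> e" using \<open>e > 0\<close> by auto
  have K': "finite ?K" "?K \<subseteq> carrier G" using K by auto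
  obtain g where g: "g \<in> l1_pos_sphere G" "\<And>a. a \<in> ?K \<Longrightarrow> translation_defect G g a < ?d"
    using psi_imp_almost_invariant[OF psi K' d(1)] by blast
  obtain k where k: "k \<in> l1_space G" "finite {x. k x \<noteq> 0}" "l1_norm G k = 1"
    and kK: "\<And>a. a \<in> ?K \<Longrightarrow> translation_defect G k a < 6 * ?d"
    using finite_support_approximation[OF g(1) d(1,2) K'(2) g(2)] by blast
  have "l1_norm G (\<lambda>x. l1_conv G (l1_flip G k) (indicator {a}) x - l1_flip G k x) < e"
    if "a \<in> K" for a
  proof -
    have "a \<in> carrier G" using that K by blast
    then have "l1_norm G (\<lambda>x. l1_conv G (l1_flip G k) (indicator {a}) x - l1_flip G k x)
        = translation_defect G k (inv a)"
      by (simp only: right_translation_eq_defect_flip l1_flip(3)[OF k(1)])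
    then show ?thesis using kK[of "inv a"] that d(3) by auto
  qed
  then show ?thesis
    using l1_flip(1,2)[OF k(1)] finite_support_flip[OF k(2)] k(3) by auto
qed

lemma psi_imp_amenable:
  assumes psi: "\<forall>n\<ge>1. psi G n"
  shows "amenable G"
proof -
  \<comment> \<open>The net is indexed by a finite set of translations together with a precision;
    \<open>Suc\<close> in the tolerance below covers \<open>m = 0\<close>.\<close>
  define I where "I = {(K, m :: nat). finite K \<and> K \<subseteq> carrier G}"
  define r where "r = (\<lambda>(K, m) (L, n). K \<subseteq> (L :: 'a set) \<and> m \<le> (n :: nat))"
  define P where "P = (\<lambda>i h. h \<in> l1_space G \<and> finite {x. h x \<noteq> 0} \<and> l1_norm G h = 1 \<and>
    (\<forall>a\<in>fst i. l1_norm G (\<lambda>x. l1_conv G h (indicator {a}) x - h x) < 1 / Suc (snd i)))"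
  have "\<exists>h. P i h" if "i \<in> I" for i
    using psi_imp_reiter[OF psi, of "fst i" "1 / Suc (snd i)"] that by (auto simp: I_def P_def)
  then obtain h where "\<And>i. i \<in> I \<Longrightarrow> P i (h i)"
    by metis
  note h = this[unfolded P_def]
  have "directed_preorder I r"
    unfolding directed_preorder_def
  proof (intro conjI ballI)
    show "I \<noteq> {}" by (auto simp: I_def)
    fix i j assume "i \<in> I" "j \<in> I"
    then show "\<exists>k\<in>I. r i k \<and> r j k"
      by (intro bexI[of _ "(fst i \<union> fst j, max (snd i) (snd j))"]) (auto simp: I_def r_def)
  qed (auto simp: r_def)
  moreover have "\<exists>i\<in>I. \<forall>j\<in>I. r i j \<longrightarrow>
      \<bar>l1_norm G (\<lambda>x. l1_conv G (h j) (indicator {a}) x - h j x)\<bar> < e"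
    if a: "a \<in> carrier G" and "e > 0" for a e
  proof -
    obtain m where m: "1 / Suc m < e"
      using \<open>e > 0\<close> nat_approx_posE by blast
    show ?thesis
    \<comment> \<open>Every later index has \<open>a\<close> in its finite set and a tolerance of at
      most \<open>1 / Suc m\<close>.\<close>
    proof (intro bexI[of _ "({a}, m)"] ballI impI)
      fix j assume j: "j \<in> I" "r ({a}, m) j"
      then have "a \<in> fst j" "m \<le> snd j" by (auto simp: r_def)
      then have "l1_norm G (\<lambda>x. l1_conv G (h j) (indicator {a}) x - h j x) < 1 / Suc (snd j)"
        using h[OF j(1)] by blast
      also have "\<dots> \<le> 1 / Suc m"
        using \<open>m \<le> snd j\<close> by (intro divide_left_mono) auto
      also note m
      finally show "\<bar>l1_norm G (\<lambda>x. l1_conv G (h j) (indicator {a}) x - h j x)\<bar> < e"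
        by (simp add: right_translation_eq_defect_flip a translation_defect_nonneg)
    qed (use a in \<open>auto simp: I_def\<close>)
  qed
  ultimately have "reiter_net G I r h"
    unfolding reiter_net_def using h by blast
  then show ?thesis by (rule amenable_if_net)
qed

end

theorem proposition3p26:
  fixes G :: "('a, 'b) monoid_scheme"
  assumes "group G"
  shows "amenable G \<longleftrightarrow> (\<forall>n\<ge>1. psi G n)"
  using group.amenable_imp_psi[OF assms] group.psi_imp_amenable[OF assms] by blast

end
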